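(* Let $\mathbf M$, $\mathcal L$, $\mathbf E_\omega(\mathcal L)$ and the constant $c_0$ be as in the context. Let $\omega>0$, let $M_\rho=\{x_k\}$ be a $\rho$-lattice in $\mathbf M$ with $\rho=c_0\omega^{-1/2}$, and let $\{\Theta_k\}$ be a frame in $\mathbf E_\omega(\mathcal L)$, indexed by the points of $M_\rho$, for which the reconstruction formula $f=\sum_{x_k\in M_\rho}f(x_k)\Theta_k$ holds for all $f\in\mathbf E_\omega(\mathcal L)$. Put $$\nu_k=\int_{\mathbf M}\Theta_k\,dx .$$ Then $$\int_{\mathbf M}f\,dx=\sum_{x_k\in M_\rho}f(x_k)\,\nu_k\qquad\text{for all } f\in\mathbf E_\omega(\mathcal L).$$
   Context: $\mathbf M$ is a compact Riemannian manifold, $n=\dim\mathbf M$, with Riemannian measure $dx$. $\mathcal L$ is an elliptic second-order differential operator on $\mathbf M$, self-adjoint in $L_2(\mathbf M)=L_2(\mathbf M,dx)$, with discrete spectrum $0=\lambda_0<\lambda_1\le\lambda_2\le\dots\to\infty$ and a corresponding complete orthonormal system of real-valued eigenfunctions $u_0,u_1,\dots$. For $\omega>0$, $\mathbf E_\omega(\mathcal L)$ is the span of all $u_j$ with $\lambda_j\le\omega$. $\rho$-lattice: there is a fixed natural number $N_{\mathbf M}$ such that for all sufficiently small $\rho>0$ there exist sets of points $\{y_\nu\}\subset\mathbf M$ with: (1) the metric balls $B(y_\nu,\rho/4)$ are disjoint; (2) the balls $B(y_\nu,\rho/2)$ cover $\mathbf M$; (3) the multiplicity of the cover by the balls $B(y_\nu,\rho)$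 is at most $N_{\mathbf M}$. Any such set is called a $\rho$-lattice $M_\rho$. It is always understood that $0<\rho<\rho_0$ for a sufficiently small constant $\rho_0=\rho_0(\mathbf M,\mathcal L)$. Constant $c_0$: put $m_0=[n/2]+1$. Let $C_2>0$ be a constant such that for all $0<\rho<\rho_0$, all $\rho$-lattices $M_\rho=\{x_k\}$ and all $f\in H^{m_0}(\mathbf M)$ one has $\|f\|_{L_2(\mathbf M)}\le C_2\{\rho^{n/2}(\sum_k|f(x_k)|^2)^{1/2}+\rho^{m_0}\|\mathcal L^{m_0/2}f\|_{L_2(\mathbf M)}\}$ (such $C_2,\rho_0$ exist). Then $c_0=\left(\tfrac12C_2^{-1}\right)^{1/m_0}$. *)

theory Defs
  imports "HOL-Analysis.Analysis"
begin

section \<open>Smooth functions on open subsets of Euclidean space\<close>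

definition partial_deriv :: "'n \<Rightarrow> (real^'n \<Rightarrow> 'b::real_normed_vector) \<Rightarrow> real^'n \<Rightarrow> 'b"
  where "partial_deriv i f x = frechet_derivative f (at x) (axis i 1)"

primrec Ck_on :: "nat \<Rightarrow> (real^'n \<Rightarrow> 'b::real_normed_vector) \<Rightarrow> (real^'n) set \<Rightarrow> bool"
  where
    "Ck_on 0 f U \<longleftrightarrow> continuous_on U f"
  | "Ck_on (Suc k) f U \<longleftrightarrow>
       (\<forall>x\<in>U. f differentiable (at x)) \<and> (\<forall>i. Ck_on k (partial_deriv i f) U)"

text \<open>Only used for open sets \<open>U\<close>.\<close>

definition smooth_on :: "(real^'n) set \<Rightarrow> (real^'n \<Rightarrow> 'b::real_normed_vector) \<Rightarrow> bool"
  where "smooth_on U f \<longleftrightarrow> (\<forall>k. Ck_on k f U)"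


section \<open>Compact Riemannian manifolds\<close>

text \<open>
  The underlying topological space of the manifold is a type \<open>'m\<close> of class \<open>t2_space\<close>; the dimension
  is \<open>CARD('n)\<close>. Together with compactness, the existence of an atlas makes the space second
  countable. Charts are onto open subsets of the full space \<open>real^'n\<close>, so there is no boundary.
\<close>

datatype ('m, 'n::finite) chart = Chart (chart_dom: "'m set") (chart_map: "'m \<Rightarrow> real^'n")

definition chart_img :: "('m, 'n::finite) chart \<Rightarrow> (real^'n) set"
  where "chart_img c = chart_map c ` chart_dom c"

definition chart_inv :: "('m, 'n::finite) chart \<Rightarrow> real^'n \<Rightarrow> 'm"
  where "chart_inv c = inv_into (chart_dom c) (chart_map c)"

definition transition :: "('m, 'n::finite) chart \<Rightarrow> ('m, 'n) chart \<Rightarrow> real^'n \<Rightarrow> real^'n"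
  where "transition c d = chart_map d \<circ> chart_inv c"

definition smooth_atlas :: "('m::t2_space, 'n::finite) chart set \<Rightarrow> bool"
  where "smooth_atlas A \<longleftrightarrow>
    (\<forall>c\<in>A. open (chart_dom c) \<and> open (chart_img c) \<and>
       homeomorphism (chart_dom c) (chart_img c) (chart_map c) (chart_inv c)) \<and>
    (\<Union>c\<in>A. chart_dom c) = UNIV \<and>
    (\<forall>c\<in>A. \<forall>d\<in>A. smooth_on (chart_map c ` (chart_dom c \<inter> chart_dom d)) (transition c d))"

text \<open>
  A Riemannian metric is given by its coefficient matrices \<open>g c x = (g\<^sub>i\<^sub>j(x))\<close> in the charts \<open>c\<close> of the
  atlas; the last clause is the transformation law of a covariant 2-tensor.
\<close>

definition riemannian_metric ::
    "('m, 'n::finite) chart set \<Rightarrow> (('m, 'n) chart \<Rightarrow> real^'n \<Rightarrow> real^'n^'n) \<Rightarrow> bool"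
  where "riemannian_metric A g \<longleftrightarrow>
    (\<forall>c\<in>A. smooth_on (chart_img c) (g c) \<and>
       (\<forall>x\<in>chart_img c. transpose (g c x) = g c x \<and> (\<forall>v. v \<noteq> 0 \<longrightarrow> 0 < v \<bullet> (g c x *v v)))) \<and>
    (\<forall>c\<in>A. \<forall>d\<in>A. \<forall>p \<in> chart_dom c \<inter> chart_dom d. \<forall>v w.
       let J = frechet_derivative (transition c d) (at (chart_map c p))
       in v \<bullet> (g c (chart_map c p) *v w) = J v \<bullet> (g d (chart_map d p) *v J w))"

definition compact_riemannian_manifold ::
    "('m::t2_space, 'n::finite) chart set \<Rightarrow> (('m, 'n) chart \<Rightarrow> real^'n \<Rightarrow> real^'n^'n) \<Rightarrow> bool"
  where "compact_riemannian_manifold A g \<longleftrightarrow>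
    compact (UNIV :: 'm set) \<and> smooth_atlas A \<and> riemannian_metric A g"

text \<open>The measure with density \<open>sqrt (det (g\<^sub>i\<^sub>j))\<close> in each chart; this determines it uniquely.\<close>

definition riemannian_measure ::
    "('m::t2_space, 'n::finite) chart set \<Rightarrow> (('m, 'n) chart \<Rightarrow> real^'n \<Rightarrow> real^'n^'n) \<Rightarrow>
      'm measure \<Rightarrow> bool"
  where "riemannian_measure A g \<mu> \<longleftrightarrow>
    sets \<mu> = sets borel \<and>
    (\<forall>c\<in>A. \<forall>B\<in>sets borel. B \<subseteq> chart_dom c \<longrightarrow>
       emeasure \<mu> B = (\<integral>\<^sup>+x\<in>chart_map c ` B. ennreal (sqrt (det (g c x))) \<partial>lborel))"

text \<open>
  \<open>curve_length A g p q l\<close>: there is a continuous piecewise \<open>C\<^sup>1\<close> curve from \<open>p\<close> to \<open>q\<close> of Riemannian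
  length \<open>l\<close>. The curve is cut into finitely many \<open>C\<^sup>1\<close> pieces each lying in the domain of one chart;
  each piece is parametrized over \<open>[0,1]\<close> and given by its coordinate expression \<open>\<gamma>\<close> with derivative
  \<open>\<gamma>'\<close>.
\<close>

inductive curve_length ::
    "('m, 'n::finite) chart set \<Rightarrow> (('m, 'n) chart \<Rightarrow> real^'n \<Rightarrow> real^'n^'n) \<Rightarrow>
      'm \<Rightarrow> 'm \<Rightarrow> real \<Rightarrow> bool"
  for A g p
  where
    start: "curve_length A g p p 0"
  | piece: "curve_length A g p (chart_inv c (\<gamma> 1)) (l + integral {0..1} (\<lambda>t. sqrt (\<gamma>' t \<bullet> (g c (\<gamma> t) *v \<gamma>' t))))"
      if "curve_length A g p (chart_inv c (\<gamma> 0)) l" "c \<in> A" "\<gamma> ` {0..1} \<subseteq> chart_img c"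
        "\<And>t. t \<in> {0..1} \<Longrightarrow> (\<gamma> has_vector_derivative \<gamma>' t) (at t within {0..1})"
        "continuous_on {0..1} \<gamma>'"

text \<open>The distance is \<open>\<infinity>\<close> between different connected components.\<close>

definition riemannian_dist ::
    "('m, 'n::finite) chart set \<Rightarrow> (('m, 'n) chart \<Rightarrow> real^'n \<Rightarrow> real^'n^'n) \<Rightarrow>
      'm \<Rightarrow> 'm \<Rightarrow> ereal"
  where "riemannian_dist A g p q = (INF l\<in>{l. curve_length A g p q l}. ereal l)"

definition riemannian_ball ::
    "('m, 'n::finite) chart set \<Rightarrow> (('m, 'n) chart \<Rightarrow> real^'n \<Rightarrow> real^'n^'n) \<Rightarrow>
      'm \<Rightarrow> real \<Rightarrow> 'm set"
  where "riemannian_ball A g p r = {q. riemannian_dist A g p q < ereal r}"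

text \<open>\<open>N\<close> is the bound on the multiplicity of the covering.\<close>

definition rho_lattice ::
    "('m, 'n::finite) chart set \<Rightarrow> (('m, 'n) chart \<Rightarrow> real^'n \<Rightarrow> real^'n^'n) \<Rightarrow>
      nat \<Rightarrow> real \<Rightarrow> 'm set \<Rightarrow> bool"
  where "rho_lattice A g N \<rho> X \<longleftrightarrow>
    disjoint_family_on (\<lambda>y. riemannian_ball A g y (\<rho>/4)) X \<and>
    (\<Union>y\<in>X. riemannian_ball A g y (\<rho>/2)) = UNIV \<and>
    (\<forall>p. finite {y\<in>X. p \<in> riemannian_ball A g y \<rho>} \<and>
         card {y\<in>X. p \<in> riemannian_ball A g y \<rho>} \<le> N)"


section \<open>Function spaces\<close>

definition smooth_fun :: "('m, 'n::finite) chart set \<Rightarrow> ('m \<Rightarrow> complex) \<Rightarrow> bool"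
  where "smooth_fun A f \<longleftrightarrow> (\<forall>c\<in>A. smooth_on (chart_img c) (f \<circ> chart_inv c))"

text \<open>Elements of \<open>L\<^sub>2\<close> are functions, not classes modulo null sets.\<close>

definition L2 :: "'m measure \<Rightarrow> ('m \<Rightarrow> complex) set"
  where "L2 \<mu> = {f. f \<in> borel_measurable \<mu> \<and> integrable \<mu> (\<lambda>x. (cmod (f x))\<^sup>2)}"

definition L2_inner :: "'m measure \<Rightarrow> ('m \<Rightarrow> complex) \<Rightarrow> ('m \<Rightarrow> complex) \<Rightarrow> complex"
  where "L2_inner \<mu> f h = (\<integral>x. f x * cnj (h x) \<partial>\<mu>)"

definition L2_norm :: "'m measure \<Rightarrow> ('m \<Rightarrow> complex) \<Rightarrow> real"
  where "L2_norm \<mu> f = sqrt (\<integral>x. (cmod (f x))\<^sup>2 \<partial>\<mu>)"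

definition test_function :: "(real^'n) set \<Rightarrow> (real^'n \<Rightarrow> complex) \<Rightarrow> bool"
  where "test_function U \<psi> \<longleftrightarrow>
    smooth_on UNIV \<psi> \<and> compact (closure {x. \<psi> x \<noteq> 0}) \<and> closure {x. \<psi> x \<noteq> 0} \<subseteq> U"

definition locally_L2 :: "(real^'n) set \<Rightarrow> (real^'n \<Rightarrow> complex) \<Rightarrow> bool"
  where "locally_L2 U w \<longleftrightarrow> w \<in> borel_measurable borel \<and>
    (\<forall>K. compact K \<longrightarrow> K \<subseteq> U \<longrightarrow> set_integrable lborel K (\<lambda>x. (cmod (w x))\<^sup>2))"

text \<open>
  The Sobolev space \<open>H\<^sup>m\<close> of a compact manifold: all weak derivatives up to order \<open>m\<close> in the charts are
  locally square integrable. A multi-index is given by the list of directions of differentiation.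
\<close>

definition sobolev ::
    "('m, 'n::finite) chart set \<Rightarrow> 'm measure \<Rightarrow> nat \<Rightarrow> ('m \<Rightarrow> complex) set"
  where "sobolev A \<mu> m = {f. f \<in> L2 \<mu> \<and>
    (\<forall>c\<in>A. \<forall>\<alpha>::'n list. length \<alpha> \<le> m \<longrightarrow>
      (\<exists>w. locally_L2 (chart_img c) w \<and>
        (\<forall>\<psi>. test_function (chart_img c) \<psi> \<longrightarrow>
          (LINT x:chart_img c|lborel. f (chart_inv c x) * foldr partial_deriv \<alpha> \<psi> x) =
          (-1) ^ length \<alpha> * (LINT x:chart_img c|lborel. w x * \<psi> x))))}"


section \<open>Elliptic self-adjoint second-order operators and their spectral data\<close>

text \<open>Operators are given on smooth functions; the values on other functions are irrelevant.\<close>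

definition elliptic_second_order ::
    "('m, 'n::finite) chart set \<Rightarrow> (('m \<Rightarrow> complex) \<Rightarrow> 'm \<Rightarrow> complex) \<Rightarrow> bool"
  where "elliptic_second_order A L \<longleftrightarrow>
    (\<forall>c\<in>A. \<exists>(a :: real^'n \<Rightarrow> complex^'n^'n) (b :: real^'n \<Rightarrow> complex^'n) (e :: real^'n \<Rightarrow> complex).
      smooth_on (chart_img c) a \<and> smooth_on (chart_img c) b \<and> smooth_on (chart_img c) e \<and>
      (\<forall>x\<in>chart_img c. \<forall>\<xi>::real^'n. \<xi> \<noteq> 0 \<longrightarrow>
         (\<Sum>i\<in>UNIV. \<Sum>j\<in>UNIV. a x $ i $ j * of_real (\<xi> $ i) * of_real (\<xi> $ j)) \<noteq> 0) \<and>
      (\<forall>f. smooth_fun A f \<longrightarrow> (\<forall>x\<in>chart_img c.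
         L f (chart_inv c x) =
           (\<Sum>i\<in>UNIV. \<Sum>j\<in>UNIV.
              a x $ i $ j * partial_deriv i (partial_deriv j (f \<circ> chart_inv c)) x) +
           (\<Sum>i\<in>UNIV. b x $ i * partial_deriv i (f \<circ> chart_inv c) x) +
           e x * f (chart_inv c x))))"

text \<open>
  Self-adjointness in \<open>L\<^sub>2\<close> of the closed operator generated by \<open>L\<close> on the smooth functions: the
  graph of its closure is the graph of its adjoint.
\<close>

definition closure_graph ::
    "('m, 'n::finite) chart set \<Rightarrow> 'm measure \<Rightarrow> (('m \<Rightarrow> complex) \<Rightarrow> 'm \<Rightarrow> complex) \<Rightarrow>
      (('m \<Rightarrow> complex) \<times> ('m \<Rightarrow> complex)) set"
  where "closure_graph A \<mu> L = {(v, w). v \<in> L2 \<mu> \<and> w \<in> L2 \<mu> \<and>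
    (\<exists>f :: nat \<Rightarrow> 'm \<Rightarrow> complex. (\<forall>k. smooth_fun A (f k)) \<and>
      (\<lambda>k. L2_norm \<mu> (\<lambda>x. f k x - v x)) \<longlonglongrightarrow> 0 \<and>
      (\<lambda>k. L2_norm \<mu> (\<lambda>x. L (f k) x - w x)) \<longlonglongrightarrow> 0)}"

definition adjoint_graph ::
    "('m, 'n::finite) chart set \<Rightarrow> 'm measure \<Rightarrow> (('m \<Rightarrow> complex) \<Rightarrow> 'm \<Rightarrow> complex) \<Rightarrow>
      (('m \<Rightarrow> complex) \<times> ('m \<Rightarrow> complex)) set"
  where "adjoint_graph A \<mu> L = {(v, w). v \<in> L2 \<mu> \<and> w \<in> L2 \<mu> \<and>
    (\<forall>f. smooth_fun A f \<longrightarrow> L2_inner \<mu> (L f) v = L2_inner \<mu> f w)}"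

definition self_adjoint ::
    "('m, 'n::finite) chart set \<Rightarrow> 'm measure \<Rightarrow> (('m \<Rightarrow> complex) \<Rightarrow> 'm \<Rightarrow> complex) \<Rightarrow> bool"
  where "self_adjoint A \<mu> L \<longleftrightarrow> closure_graph A \<mu> L = adjoint_graph A \<mu> L"

abbreviation cfun :: "('m \<Rightarrow> real) \<Rightarrow> 'm \<Rightarrow> complex"
  where "cfun f \<equiv> (\<lambda>x. complex_of_real (f x))"

definition complete_orthonormal :: "'m measure \<Rightarrow> (nat \<Rightarrow> 'm \<Rightarrow> complex) \<Rightarrow> bool"
  where "complete_orthonormal \<mu> e \<longleftrightarrow>
    (\<forall>j. e j \<in> L2 \<mu>) \<and>
    (\<forall>i j. L2_inner \<mu> (e i) (e j) = (if i = j then 1 else 0)) \<and>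
    (\<forall>f\<in>L2 \<mu>. (\<lambda>k. L2_norm \<mu> (\<lambda>x. f x - (\<Sum>j<k. L2_inner \<mu> f (e j) * e j x))) \<longlonglongrightarrow> 0)"

text \<open>
  The eigenvalues are enumerated with multiplicity. As they tend to infinity and the eigenfunctions are
  complete, they exhaust the spectrum.
\<close>

definition spectral_data ::
    "('m, 'n::finite) chart set \<Rightarrow> 'm measure \<Rightarrow> (('m \<Rightarrow> complex) \<Rightarrow> 'm \<Rightarrow> complex) \<Rightarrow>
      (nat \<Rightarrow> real) \<Rightarrow> (nat \<Rightarrow> 'm \<Rightarrow> real) \<Rightarrow> bool"
  where "spectral_data A \<mu> L ev u \<longleftrightarrow>
    ev 0 = 0 \<and> 0 < ev 1 \<and> mono ev \<and> filterlim ev at_top sequentially \<and>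
    (\<forall>j. smooth_fun A (cfun (u j)) \<and> L (cfun (u j)) = (\<lambda>x. of_real (ev j) * cfun (u j) x)) \<and>
    complete_orthonormal \<mu> (\<lambda>j. cfun (u j))"

text \<open>The index set of the sum is finite because \<open>ev\<close> tends to infinity.\<close>

definition bandlimited :: "(nat \<Rightarrow> real) \<Rightarrow> (nat \<Rightarrow> 'm \<Rightarrow> real) \<Rightarrow> real \<Rightarrow> ('m \<Rightarrow> complex) set"
  where "bandlimited ev u \<omega> =
    {f. \<exists>a :: nat \<Rightarrow> complex. f = (\<lambda>x. \<Sum>j | ev j \<le> \<omega>. a j * cfun (u j) x)}"

text \<open>\<open>h = L\<^sup>s f\<close> in the sense of the functional calculus, for real \<open>s > 0\<close>.\<close>

definition spectral_power ::
    "'m measure \<Rightarrow> (nat \<Rightarrow> real) \<Rightarrow> (nat \<Rightarrow> 'm \<Rightarrow> real) \<Rightarrow> real \<Rightarrow>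
      ('m \<Rightarrow> complex) \<Rightarrow> ('m \<Rightarrow> complex) \<Rightarrow> bool"
  where "spectral_power \<mu> ev u s f h \<longleftrightarrow> h \<in> L2 \<mu> \<and>
    (\<forall>j. L2_inner \<mu> h (cfun (u j)) = of_real (ev j powr s) * L2_inner \<mu> f (cfun (u j)))"


section \<open>Sampling on lattices\<close>

text \<open>
  Point values of \<open>f \<in> H\<^sup>m\<close> with \<open>m > n/2\<close> are those of its continuous representative.
\<close>

definition sampling_inequality ::
    "('m::t2_space, 'n::finite) chart set \<Rightarrow> (('m, 'n) chart \<Rightarrow> real^'n \<Rightarrow> real^'n^'n) \<Rightarrow>
      'm measure \<Rightarrow> (nat \<Rightarrow> real) \<Rightarrow> (nat \<Rightarrow> 'm \<Rightarrow> real) \<Rightarrow> nat \<Rightarrow> real \<Rightarrow> nat \<Rightarrow> real \<Rightarrow> bool"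
  where "sampling_inequality A g \<mu> ev u N \<rho>\<^sub>0 m C \<longleftrightarrow>
    (\<forall>\<rho> X f h. 0 < \<rho> \<longrightarrow> \<rho> < \<rho>\<^sub>0 \<longrightarrow> rho_lattice A g N \<rho> X \<longrightarrow>
       f \<in> sobolev A \<mu> m \<longrightarrow> continuous_on UNIV f \<longrightarrow> spectral_power \<mu> ev u (real m / 2) f h \<longrightarrow>
       L2_norm \<mu> f \<le> C * (\<rho> powr (real CARD('n) / 2) * sqrt (\<Sum>x\<in>X. (cmod (f x))\<^sup>2)
                           + \<rho> ^ m * L2_norm \<mu> h))"

definition frame_in :: "'m measure \<Rightarrow> ('m \<Rightarrow> complex) set \<Rightarrow> 'k set \<Rightarrow> ('k \<Rightarrow> 'm \<Rightarrow> complex) \<Rightarrow> bool"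
  where "frame_in \<mu> E K \<Theta> \<longleftrightarrow> (\<forall>k\<in>K. \<Theta> k \<in> E) \<and>
    (\<exists>a b. 0 < a \<and> 0 < b \<and> (\<forall>f\<in>E.
       (\<lambda>k. (cmod (L2_inner \<mu> f (\<Theta> k)))\<^sup>2) summable_on K \<and>
       a * (L2_norm \<mu> f)\<^sup>2 \<le> (\<Sum>\<^sub>\<infinity>k\<in>K. (cmod (L2_inner \<mu> f (\<Theta> k)))\<^sup>2) \<and>
       (\<Sum>\<^sub>\<infinity>k\<in>K. (cmod (L2_inner \<mu> f (\<Theta> k)))\<^sup>2) \<le> b * (L2_norm \<mu> f)\<^sup>2))"


section \<open>Lattices on a compact manifold are finite\<close>

text \<open>Hence the sums over the points of a lattice are ordinary finite sums.\<close>

lemma norm_matrix_vector_le: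
  fixes B :: "real^'n^'n"
  shows "norm (B *v v) \<le> real CARD('n) * real CARD('n) * norm B * norm v"
proof -
  have "\<bar>B $ i $ j\<bar> \<le> norm B" for i j
    using component_le_norm_cart[of "B $ i" j] Finite_Cartesian_Product.norm_nth_le[of B i] by linarith
  then have "onorm ((*v) B) \<le> real CARD('n) * real CARD('n) * norm B"
    by (rule onorm_le_matrix_component)
  moreover have "norm (B *v v) \<le> onorm ((*v) B) * norm v"
    by (rule onorm[OF matrix_vector_mul_bounded_linear])
  ultimately show ?thesis
    by (meson mult_right_mono norm_ge_zero order_trans)
qed

lemma small_ball_contains_point:
  fixes A :: "('m::t2_space, 'n::finite) chart set"
  assumes man: "compact_riemannian_manifold A g" and r: "0 < r"
  obtains U where "open U" "p \<in> U" "\<And>q. q \<in> U \<Longrightarrow> p \<in> riemannian_ball A g q r"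
proof -
  from man have atlas: "smooth_atlas A" and met: "riemannian_metric A g"
    by (auto simp: compact_riemannian_manifold_def)
  from atlas obtain c where c: "c \<in> A" "p \<in> chart_dom c"
    by (force simp: smooth_atlas_def)
  let ?x = "chart_map c p" and ?I = "chart_img c"
  have opn: "open (chart_dom c)" "open ?I"
    and hom: "homeomorphism (chart_dom c) ?I (chart_map c) (chart_inv c)"
    using atlas c(1) by (auto simp: smooth_atlas_def)
  have inv: "chart_inv c (chart_map c q) = q" if "q \<in> chart_dom c" for q
    using hom that by (auto simp: homeomorphism_def)
  have xI: "?x \<in> ?I" using c(2) by (auto simp: chart_img_def)
  have "Ck_on 0 (g c) ?I" using met c(1) unfolding riemannian_metric_def smooth_on_def by blast
  then have contg: "continuous_on ?I (g c)" by simp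
  obtain e where e: "0 < e" "cball ?x e \<subseteq> ?I"
    using opn(2) xI open_contains_cball by blast
  have "compact (g c ` cball ?x e)"
    by (intro compact_continuous_image continuous_on_subset[OF contg] e compact_cball)
  then obtain B where B: "0 < B" "\<And>y. y \<in> cball ?x e \<Longrightarrow> norm (g c y) \<le> B"
    using compact_imp_bounded bounded_pos by (metis image_eqI)
  define K where "K = real CARD('n) * real CARD('n) * B"
  have K: "0 < K" using B(1) by (simp add: K_def)
  have bound: "sqrt (v \<bullet> (g c y *v v)) \<le> sqrt K * norm v" if "y \<in> cball ?x e" for y v
  proof -
    have "v \<bullet> (g c y *v v) \<le> norm v * norm (g c y *v v)" by (rule norm_cauchy_schwarz)
    also have "\<dots> \<le> norm v * (real CARD('n) * real CARD('n) * norm (g c y) * norm v)"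
      by (intro mult_left_mono norm_matrix_vector_le norm_ge_zero)
    also have "\<dots> \<le> norm v * (K * norm v)"
      unfolding K_def using B(2)[OF that]
      by (intro mult_left_mono mult_right_mono) auto
    finally have "v \<bullet> (g c y *v v) \<le> K * (norm v)\<^sup>2" by (simp add: power2_eq_square mult_ac)
    then have "sqrt (v \<bullet> (g c y *v v)) \<le> sqrt (K * (norm v)\<^sup>2)" by simp
    then show ?thesis by (simp add: real_sqrt_mult)
  qed
  define d where "d = min e (r / (2 * sqrt K))"
  have d: "0 < d" "d \<le> e" "sqrt K * d < r"
  proof -
    show "0 < d" "d \<le> e" using e K r by (auto simp: d_def)
    have "sqrt K * d \<le> sqrt K * (r / (2 * sqrt K))" using K by (intro mult_left_mono) (auto simp: d_def)
    also have "\<dots> = r / 2" using K by simp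
    finally show "sqrt K * d < r" using r by simp
  qed
  define U where "U = {q \<in> chart_dom c. chart_map c q \<in> ball ?x d}"
  show thesis
  proof (rule that)
    have "continuous_on (chart_dom c) (chart_map c)" using hom by (simp add: homeomorphism_def)
    then have "open (chart_map c -` ball ?x d \<inter> chart_dom c)"
      using continuous_on_open_vimage[OF opn(1)] by blast
    then show "open U" by (simp add: U_def vimage_def Int_def conj_commute)
    show "p \<in> U" using c d by (simp add: U_def)
  next
    fix q assume "q \<in> U"
    then have q: "q \<in> chart_dom c" "chart_map c q \<in> ball ?x d" by (auto simp: U_def)
    let ?y = "chart_map c q"
    let ?\<gamma> = "\<lambda>t. ?y + t *\<^sub>R (?x - ?y)" and ?\<gamma>' = "\<lambda>t::real. ?x - ?y"
    have seg: "?\<gamma> t \<in> cball ?x e" if "t \<in> {0..1}" for t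
    proof -
      have "?\<gamma> t = (1 - t) *\<^sub>R ?y + t *\<^sub>R ?x" by (simp add: algebra_simps)
      also have "\<dots> \<in> cball ?x e"
        using that q(2) d(1,2) e(1) by (intro convexD[OF convex_cball]) auto
      finally show ?thesis .
    qed
    have len: "curve_length A g q (chart_inv c (?\<gamma> 1))
        (0 + integral {0..1} (\<lambda>t. sqrt (?\<gamma>' t \<bullet> (g c (?\<gamma> t) *v ?\<gamma>' t))))"
    proof (rule curve_length.piece)
      show "curve_length A g q (chart_inv c (?\<gamma> 0)) 0"
        using curve_length.start[of A g q] inv[OF q(1)] by simp
      show "c \<in> A" by (rule c)
      show "?\<gamma> ` {0..1} \<subseteq> ?I" using seg e(2) by blast
      show "(?\<gamma> has_vector_derivative ?\<gamma>' t) (at t within {0..1})" for t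
        by (auto intro!: derivative_eq_intros)
      show "continuous_on {0..1} ?\<gamma>'" by simp
    qed
    define l where "l = integral {0..1} (\<lambda>t. sqrt (?\<gamma>' t \<bullet> (g c (?\<gamma> t) *v ?\<gamma>' t)))"
    have "norm l \<le> sqrt K * norm (?x - ?y) * (1 - 0)"
      unfolding l_def
    proof (rule integral_bound)
      have "continuous_on {0..1} (\<lambda>t. g c (?\<gamma> t))"
        using seg e(2)
        by (intro continuous_on_compose2[OF contg] continuous_intros) auto
      then show "continuous_on {0..1} (\<lambda>t. sqrt (?\<gamma>' t \<bullet> (g c (?\<gamma> t) *v ?\<gamma>' t)))"
        unfolding matrix_vector_mult_def
        by (intro continuous_intros) auto
    next
      fix t :: real assume t: "t \<in> {0..1}"
      have "0 \<le> ?\<gamma>' t \<bullet> (g c (?\<gamma> t) *v ?\<gamma>' t)"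
        using met c(1) seg[OF t] e(2) unfolding riemannian_metric_def
        by (cases "?\<gamma>' t = 0") (auto intro!: less_imp_le simp: subset_iff)
      then show "norm (sqrt (?\<gamma>' t \<bullet> (g c (?\<gamma> t) *v ?\<gamma>' t))) \<le> sqrt K * norm (?x - ?y)"
        using bound[OF seg[OF t], of "?\<gamma>' t"] by simp
    qed simp
    also have "\<dots> \<le> sqrt K * d"
      using q(2) K by (auto simp: dist_norm intro!: mult_left_mono)
    finally have "l < r" using d(3) by simp
    moreover have "curve_length A g q p l" using len inv[OF c(2)] by (simp add: l_def)
    ultimately have "riemannian_dist A g q p < ereal r"
      unfolding riemannian_dist_def INF_less_iff by auto
    then show "p \<in> riemannian_ball A g q r" by (simp add: riemannian_ball_def)
  qed
qed


lemma finite_rho_lattice: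
  fixes A :: "('m::t2_space, 'n::finite) chart set"
  assumes man: "compact_riemannian_manifold A g" and rho: "0 < \<rho>" and lat: "rho_lattice A g N \<rho> X"
  shows "finite X"
proof -
  have "\<forall>p. \<exists>U. open U \<and> p \<in> U \<and> (\<forall>q\<in>U. p \<in> riemannian_ball A g q (\<rho>/4))"
    using small_ball_contains_point[OF man, of "\<rho>/4"] rho by (metis divide_pos_pos zero_less_numeral)
  then obtain U where U: "\<And>p. open (U p)" "\<And>p. p \<in> U p"
      "\<And>p q. q \<in> U p \<Longrightarrow> p \<in> riemannian_ball A g q (\<rho>/4)"
    by metis
  have "compact (UNIV :: 'm set)" using man by (simp add: compact_riemannian_manifold_def)
  moreover have "UNIV \<subseteq> (\<Union>p\<in>UNIV. U p)" using U(2) by blast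
  ultimately obtain P where P: "finite P" "UNIV \<subseteq> (\<Union>p\<in>P. U p)"
    using U(1) by (metis compactE_image)
  have "\<forall>x\<in>X. \<exists>p\<in>P. x \<in> U p" using P by blast
  then obtain s where s: "\<And>x. x \<in> X \<Longrightarrow> s x \<in> P \<and> x \<in> U (s x)" by metis
  have "inj_on s X"
  proof (rule inj_onI)
    fix x y assume xy: "x \<in> X" "y \<in> X" "s x = s y"
    have "s x \<in> riemannian_ball A g x (\<rho>/4) \<inter> riemannian_ball A g y (\<rho>/4)"
      using s[OF xy(1)] s[OF xy(2)] U(3) xy(3) by auto
    then show "x = y"
      using lat xy(1,2) unfolding rho_lattice_def disjoint_family_on_def by blast
  qed
  moreover have "s ` X \<subseteq> P" using s by blast
  ultimately show ?thesis using P(1) by (meson finite_imageD finite_subset)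
qed

end

theory Submission
  imports Defs
begin

text \<open>
  Integrate the reconstruction formula termwise. This needs the \<open>\<Theta>\<^sub>k\<close> to be integrable: they are finite
  combinations of eigenfunctions, hence square integrable, and the Riemannian measure of a compact
  manifold is finite because its density is bounded on small balls in the charts.
\<close>

text \<open>By the Leibniz expansion the determinant is a polynomial in the entries. This makes the
  density \<open>sqrt (det (g c y))\<close> continuous.\<close>

lemma continuous_on_det [continuous_intros]:
  fixes M :: "'a::topological_space \<Rightarrow> real^'n^'n"
  assumes "continuous_on S M"
  shows "continuous_on S (\<lambda>x. det (M x))"
  unfolding det_def by (intro continuous_intros assms)

text \<open>In a chart around \<open>p\<close> the density is continuous, hence bounded on a closed
  coordinate ball, and that ball has finite Lebesgue measure.\<close>

lemma riemannian_measure_locally_finite: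
  fixes A :: "('m::t2_space, 'n::finite) chart set"
  assumes atlas: "smooth_atlas A" and met: "riemannian_metric A g"
    and \<mu>: "riemannian_measure A g \<mu>"
  obtains U where "open U" "p \<in> U" "emeasure \<mu> U < \<infinity>"
proof -
  from atlas obtain c where c: "c \<in> A" "p \<in> chart_dom c"
    by (force simp: smooth_atlas_def)
  let ?x = "chart_map c p" and ?I = "chart_img c"
  have opn: "open (chart_dom c)" "open ?I"
    and hom: "homeomorphism (chart_dom c) ?I (chart_map c) (chart_inv c)"
    using atlas c(1) by (auto simp: smooth_atlas_def)
  have xI: "?x \<in> ?I" using c(2) by (auto simp: chart_img_def)
  have "Ck_on 0 (g c) ?I" using met c(1) unfolding riemannian_metric_def smooth_on_def by blast
  then have contg: "continuous_on ?I (g c)" by simp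
  obtain e where e: "0 < e" "cball ?x e \<subseteq> ?I"
    using opn(2) xI open_contains_cball by blast
  \<comment> \<open>\<open>sqrt\<close> extends to negative reals as an odd continuous function, so
    continuity of the density follows from that of \<open>det\<close> alone.\<close>
  have "compact ((\<lambda>y. sqrt (det (g c y))) ` cball ?x e)"
    by (intro compact_continuous_image continuous_intros continuous_on_subset[OF contg] e compact_cball)
  then obtain B where B: "\<And>y. y \<in> cball ?x e \<Longrightarrow> \<bar>sqrt (det (g c y))\<bar> \<le> B"
    using compact_imp_bounded bounded_pos by (metis image_eqI real_norm_def)
  \<comment> \<open>The open ball makes \<open>U\<close> open, while the bound \<open>B\<close>
    comes from the compact closed ball of the same radius.\<close>
  define U where "U = chart_map c -` ball ?x e \<inter> chart_dom c"
  show thesis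
  proof (rule that)
    have "continuous_on (chart_dom c) (chart_map c)" using hom by (simp add: homeomorphism_def)
    then show "open U"
      unfolding U_def using continuous_on_open_vimage[OF opn(1)] by blast
    then have "U \<in> sets borel" by simp
    then have "emeasure \<mu> U = (\<integral>\<^sup>+x\<in>chart_map c ` U. ennreal (sqrt (det (g c x))) \<partial>lborel)"
      using \<mu> c(1) by (simp add: riemannian_measure_def U_def)
    also have "\<dots> \<le> (\<integral>\<^sup>+x. ennreal B * indicator (cball ?x e) x \<partial>lborel)"
    proof (rule nn_integral_mono)
      fix y :: "real^'n"
      show "ennreal (sqrt (det (g c y))) * indicator (chart_map c ` U) y
          \<le> ennreal B * indicator (cball ?x e) y"
      proof (cases "y \<in> chart_map c ` U")
        case True
        then have "y \<in> cball ?x e" by (auto simp: U_def)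
        with B[OF this] show ?thesis using True by (auto intro!: ennreal_leI)
      qed simp
    qed
    also have "\<dots> = ennreal B * emeasure lborel (cball ?x e)"
      by (simp add: nn_integral_cmult_indicator)
    also have "\<dots> < \<infinity>"
      using emeasure_lborel_cball_finite[of ?x e] by (simp add: ennreal_mult_less_top)
    finally show "emeasure \<mu> U < \<infinity>" .
    show "p \<in> U" using c e by (simp add: U_def)
  qed
qed

text \<open>Compactness leaves finitely many neighbourhoods of finite measure covering the manifold;
  subadditivity then bounds the total mass.\<close>

lemma riemannian_measure_finite:
  fixes A :: "('m::t2_space, 'n::finite) chart set"
  assumes man: "compact_riemannian_manifold A g" and \<mu>: "riemannian_measure A g \<mu>"
  shows "finite_measure \<mu>"
proof
  have "\<forall>p. \<exists>U. open U \<and> p \<in> U \<and> emeasure \<mu> U < \<infinity>"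
    using riemannian_measure_locally_finite man \<mu>
    unfolding compact_riemannian_manifold_def by metis
  then obtain U where U: "\<And>p. open (U p)" "\<And>p. p \<in> U p" "\<And>p. emeasure \<mu> (U p) < \<infinity>"
    by metis
  have "compact (UNIV :: 'm set)" using man by (simp add: compact_riemannian_manifold_def)
  moreover have "UNIV \<subseteq> (\<Union>p\<in>UNIV. U p)" using U(2) by blast
  ultimately obtain P where P: "finite P" "UNIV \<subseteq> (\<Union>p\<in>P. U p)"
    using U(1) by (metis compactE_image)
  have sets: "sets \<mu> = sets borel" using \<mu> by (simp add: riemannian_measure_def)
  \<comment> \<open>Equal sigma-algebras have equal underlying spaces, so the space of
    \<open>\<mu>\<close> is the whole type.\<close>
  then have "space \<mu> = (\<Union>p\<in>P. U p)" using sets_eq_imp_space_eq[OF sets] P(2) by auto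
  then have "emeasure \<mu> (space \<mu>) \<le> (\<Sum>p\<in>P. emeasure \<mu> (U p))"
    using P(1) U(1) sets by (auto intro!: emeasure_subadditive_finite)
  also have "\<dots> < \<infinity>" using U(3) P(1) by (simp add: ennreal_sum_less_top)
  finally show "emeasure \<mu> (space \<mu>) \<noteq> \<infinity>" by simp
qed

text \<open>Constants are integrable for a finite measure, so
  \<open>1 + (cmod (f x))\<^sup>2\<close> is an integrable majorant of \<open>f\<close>.\<close>

lemma (in finite_measure) L2_imp_integrable:
  assumes "f \<in> L2 M"
  shows "integrable M f"
proof (rule Bochner_Integration.integrable_bound)
  show "integrable M (\<lambda>x. 1 + (cmod (f x))\<^sup>2)" and "f \<in> borel_measurable M"
    using assms by (auto simp: L2_def)
  \<comment> \<open>Expanding the square of \<open>t - 1/2\<close> even gives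
    \<open>t \<le> 1/4 + t\<^sup>2\<close>.\<close>
  have "t \<le> 1 + t\<^sup>2" for t :: real
    using zero_le_power2[of "t - 1/2"] by (simp add: power2_eq_square algebra_simps)
  then show "AE x in M. norm (f x) \<le> norm (1 + (cmod (f x))\<^sup>2)"
    by simp
qed

theorem theorem3p2:
  fixes A :: "('m::t2_space, 'n::finite) chart set"
    and g :: "('m, 'n) chart \<Rightarrow> real^'n \<Rightarrow> real^'n^'n"
    and \<mu> :: "'m measure"
    and L :: "('m \<Rightarrow> complex) \<Rightarrow> 'm \<Rightarrow> complex"
    and ev :: "nat \<Rightarrow> real" and u :: "nat \<Rightarrow> 'm \<Rightarrow> real"
    and N m\<^sub>0 :: nat and \<rho>\<^sub>0 C\<^sub>2 c\<^sub>0 \<omega> \<rho> :: real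
    and X :: "'m set" and \<Theta> :: "'m \<Rightarrow> 'm \<Rightarrow> complex" and \<nu> :: "'m \<Rightarrow> complex"
  assumes manifold: "compact_riemannian_manifold A g" "riemannian_measure A g \<mu>"
    and operator: "elliptic_second_order A L" "self_adjoint A \<mu> L"
    and spectrum: "spectral_data A \<mu> L ev u"
    and multiplicity: "\<exists>r>0. \<forall>\<rho>'. 0 < \<rho>' \<and> \<rho>' < r \<longrightarrow> (\<exists>Y. rho_lattice A g N \<rho>' Y)"
    and m\<^sub>0: "m\<^sub>0 = CARD('n) div 2 + 1"
    and C\<^sub>2: "0 < \<rho>\<^sub>0" "0 < C\<^sub>2" "sampling_inequality A g \<mu> ev u N \<rho>\<^sub>0 m\<^sub>0 C\<^sub>2"
    and c\<^sub>0: "c\<^sub>0 = (1 / (2 * C\<^sub>2)) powr (1 / real m\<^sub>0)"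
    and omega: "0 < \<omega>"
    and lattice: "\<rho> = c\<^sub>0 * \<omega> powr (- 1 / 2)" "\<rho> < \<rho>\<^sub>0" "rho_lattice A g N \<rho> X"
    and frame: "frame_in \<mu> (bandlimited ev u \<omega>) X \<Theta>"
    and reconstruction:
      "\<And>f y. f \<in> bandlimited ev u \<omega> \<Longrightarrow> f y = (\<Sum>x\<in>X. f x * \<Theta> x y)"
    and weights: "\<And>x. x \<in> X \<Longrightarrow> \<nu> x = (\<integral>y. \<Theta> x y \<partial>\<mu>)"
  shows "\<forall>f \<in> bandlimited ev u \<omega>. (\<integral>y. f y \<partial>\<mu>) = (\<Sum>x\<in>X. f x * \<nu> x)"
proof
  interpret finite_measure \<mu>
    using manifold by (rule riemannian_measure_finite)
  have "integrable \<mu> (cfun (u j))" for j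
    using spectrum by (intro L2_imp_integrable) (simp add: spectral_data_def complete_orthonormal_def)
  then have "integrable \<mu> h" if "h \<in> bandlimited ev u \<omega>" for h
    using that by (auto simp: bandlimited_def
        intro!: Bochner_Integration.integrable_sum integrable_mult_right)
  \<comment> \<open>Members of a frame in the band-limited space belong to that space, so the
    preceding fact applies to each of them.\<close>
  then have \<Theta>: "integrable \<mu> (\<Theta> x)" if "x \<in> X" for x
    using frame that by (simp add: frame_in_def)
  fix f assume f: "f \<in> bandlimited ev u \<omega>"
  have "(\<integral>y. f y \<partial>\<mu>) = (\<integral>y. (\<Sum>x\<in>X. f x * \<Theta> x y) \<partial>\<mu>)"
    using reconstruction[OF f] by metis
  \<comment> \<open>Linearity of the integral: each summand is the constant \<open>f x\<close> times
    the integrable function \<open>\<Theta> x\<close>.\<close>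
  also have "\<dots> = (\<Sum>x\<in>X. \<integral>y. f x * \<Theta> x y \<partial>\<mu>)"
    using \<Theta> by (intro Bochner_Integration.integral_sum integrable_mult_right)
  also have "\<dots> = (\<Sum>x\<in>X. f x * \<nu> x)"
    by (simp add: weights)
  finally show "(\<integral>y. f y \<partial>\<mu>) = (\<Sum>x\<in>X. f x * \<nu> x)" .
qed

end
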